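(* Let $\mathcal{H}$ be a Hilbert space and let $T:\mathcal{H}\to\mathcal{H}$ be a bounded linear operator. If $T$ has closed range and $T$ is normal or hyponormal, then $T^n$ has closed range for every integer $n\ge 1$.
   Context: A bounded linear operator $T$ on a Hilbert space is normal if $TT^{*}=T^{*}T$, and hyponormal if $TT^{*}\le T^{*}T$, i.e. $T^{*}T-TT^{*}$ is a positive (positive semidefinite) operator. Here $T^*$ denotes the Hilbert-space adjoint of $T$. *)

theory Defs
  imports "HOL-Analysis.Analysis"
begin

text \<open>
  The scalars of a Hilbert space are the reals or the complex numbers. Both cases are covered by
  the following class; lemma \<open>scalar_real_or_complex\<close> shows that it has no other members.
\<close>

class hilbert_scalar = real_normed_field +
  fixes sconj :: "'a \<Rightarrow> 'a"
  assumes sconj_add: "sconj (x + y) = sconj x + sconj y"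
    and sconj_mult: "sconj (x * y) = sconj x * sconj y"
    and mult_sconj_scaleR: "x * sconj x = (norm x)\<^sup>2 *\<^sub>R 1"

lemma mult_sconj: "x * sconj x = of_real ((norm x)\<^sup>2)" for x :: "'k::hilbert_scalar"
  by (simp only: of_real_def mult_sconj_scaleR)

instantiation real :: hilbert_scalar
begin
definition sconj_real :: "real \<Rightarrow> real" where "sconj_real x = x"
instance
  by standard (simp_all add: sconj_real_def power2_eq_square)
end

instantiation complex :: hilbert_scalar
begin
definition sconj_complex :: "complex \<Rightarrow> complex" where "sconj_complex z = cnj z"
instance
  by standard (simp_all add: sconj_complex_def scaleR_conv_of_real complex_norm_square del: of_real_power)
end

lemma sconj_of_real: "sconj (of_real r :: 'k::hilbert_scalar) = of_real r"
proof (cases "r = 0")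
  case True
  have "sconj (0 + 0 :: 'k) = sconj 0 + sconj 0" by (rule sconj_add)
  then show ?thesis using True by simp
next
  case False
  have "of_real r * sconj (of_real r :: 'k) = of_real r * of_real r"
    by (simp add: mult_sconj power2_eq_square)
  then show ?thesis using False by simp
qed

lemma sconj_fixed_real:
  fixes y :: "'k::hilbert_scalar"
  assumes "sconj y = y"
  shows "\<exists>a. y = of_real a"
proof -
  have "y * y = of_real (norm y) * of_real (norm y)"
    using mult_sconj[of y] assms by (simp add: power2_eq_square)
  then have "y = of_real (norm y) \<or> y = - of_real (norm y)"
    by (simp add: square_eq_iff)
  then show ?thesis by (metis of_real_minus)
qed

lemma sconj_minus: "sconj (- x) = - sconj (x :: 'k::hilbert_scalar)"
  using sconj_mult[of "of_real (-1)" x] by (simp only: sconj_of_real) simp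

lemma sconj_sconj: "sconj (sconj x) = (x :: 'k::hilbert_scalar)"
proof (cases "x = 0")
  case True
  then show ?thesis using sconj_of_real[of 0, where 'k = 'k] by simp
next
  case False
  have "sconj x * sconj (sconj x) = sconj (of_real ((norm x)\<^sup>2))"
    by (metis mult_sconj sconj_mult)
  also have "\<dots> = sconj x * x"
    by (simp only: sconj_of_real) (metis mult.commute mult_sconj)
  finally have "sconj x * sconj (sconj x) = sconj x * x" .
  moreover have "x * sconj x \<noteq> 0"
    using False by (simp add: mult_sconj)
  ultimately show ?thesis by auto
qed

lemma scalar_real_or_complex:
  "(\<forall>x :: 'k::hilbert_scalar. \<exists>a. x = of_real a) \<or>
   (\<exists>i :: 'k. i * i = - 1 \<and> sconj i = - i \<and> (\<forall>x. \<exists>a b. x = of_real a + of_real b * i))"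
proof (cases "\<exists>z :: 'k. z \<noteq> 0 \<and> sconj z = - z")
  case True
  then obtain z :: 'k where z: "z \<noteq> 0" "sconj z = - z" by blast
  define i where "i = of_real (1 / norm z) * z"
  have ci: "sconj i = - i"
    by (simp only: i_def sconj_mult sconj_of_real z) simp
  have "norm i = 1" using z by (simp add: i_def norm_mult norm_divide)
  then have ii: "i * i = - 1"
    using mult_sconj[of i] ci by (simp add: minus_equation_iff[of _ 1])
  have "\<exists>a b. x = of_real a + of_real b * i" for x
  proof -
    have "sconj (x + sconj x) = x + sconj x"
      by (simp add: sconj_add sconj_sconj)
    then obtain p where p: "x + sconj x = of_real p"
      using sconj_fixed_real by blast
    have "sconj ((x - sconj x) * i) = (x - sconj x) * i"
      using sconj_add[of x "- sconj x"]
      by (simp add: sconj_mult sconj_minus sconj_sconj ci) (simp add: algebra_simps)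
    then obtain q where q: "(x - sconj x) * i = of_real q"
      using sconj_fixed_real by blast
    have "x - sconj x = - ((x - sconj x) * (i * i))"
      by (simp add: ii)
    also have "\<dots> = - of_real q * i"
      by (simp only: mult.assoc[symmetric] q mult_minus_left)
    finally have d: "x - sconj x = - of_real q * i" .
    have "x = ((x + sconj x) + (x - sconj x)) / 2"
      by simp
    also have "\<dots> = (of_real p + - of_real q * i) / 2"
      by (simp only: p d)
    also have "\<dots> = of_real (p / 2) + of_real (- q / 2) * i"
      by (simp add: diff_divide_distrib)
    finally show ?thesis by blast
  qed
  then show ?thesis using ii ci by blast
next
  case False
  have "\<exists>a. x = of_real a" for x :: 'k
  proof -
    have "sconj (x - sconj x) = - (x - sconj x)"
      using sconj_add[of x "- sconj x"] by (simp add: sconj_minus sconj_sconj)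
    with False have "x - sconj x = 0" by blast
    then have "sconj x = x" by (simp only: right_minus_eq)
    then show ?thesis by (rule sconj_fixed_real)
  qed
  then show ?thesis by blast
qed

text \<open>
  The inner product is linear in the first argument. Since the type class fixes the norm (hence the
  topology) and the real scalar multiplication of the underlying type, these are required to be the
  ones given by the inner product and by \<open>smul\<close>; the equation \<open>inner_self\<close> includes positive
  definiteness. Completeness is part of class \<^class>\<open>banach\<close>.
\<close>

locale hilbert_space = vector_space smul
  for smul :: "'k::hilbert_scalar \<Rightarrow> 'a::banach \<Rightarrow> 'a" +
  fixes ip :: "'a \<Rightarrow> 'a \<Rightarrow> 'k"
  assumes scale_of_real: "smul (of_real r) x = r *\<^sub>R x"
    and inner_add_left: "ip (x + y) z = ip x z + ip y z"
    and inner_scale_left: "ip (smul c x) y = c * ip x y"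
    and inner_conj_sym: "ip y x = sconj (ip x y)"
    and inner_self: "ip x x = of_real ((norm x)\<^sup>2)"

lemma hilbert_space_real:
  "hilbert_space scaleR (inner :: 'a::{real_inner,banach} \<Rightarrow> 'a \<Rightarrow> real)"
  by unfold_locales
    (simp_all add: algebra_simps sconj_real_def inner_commute power2_norm_eq_inner)

lemma hilbert_space_complex_vec:
  "hilbert_space (*s) (\<lambda>x y :: complex ^ 'n::finite. \<Sum>i\<in>UNIV. x $ i * cnj (y $ i))"
proof unfold_locales
  show "(\<Sum>i\<in>UNIV. x $ i * cnj (x $ i)) = complex_of_real ((norm x)\<^sup>2)" for x :: "complex ^ 'n"
    by (simp add: norm_vec_def L2_set_def sum_nonneg)
      (simp only: complex_norm_square[symmetric] of_real_power)
  show "complex_of_real r *s x = r *\<^sub>R x" for r and x :: "complex ^ 'n"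
    by (simp add: vec_eq_iff scaleR_conv_of_real[where 'a = complex])
qed (simp_all add: vec_eq_iff algebra_simps sum.distrib sum_distrib_left sconj_complex_def)

definition bounded_operator :: "('k::hilbert_scalar \<Rightarrow> 'a::banach \<Rightarrow> 'a) \<Rightarrow> ('a \<Rightarrow> 'a) \<Rightarrow> bool" where
  "bounded_operator smul T \<longleftrightarrow>
     Vector_Spaces.linear smul smul T \<and> (\<exists>K. \<forall>x. norm (T x) \<le> K * norm x)"

text \<open>
  As in the library's \<^const>\<open>adjoint\<close>; for a bounded operator on a Hilbert space the
  function described exists by the Riesz representation theorem and is unique.
\<close>

definition hilbert_adjoint :: "('a \<Rightarrow> 'a \<Rightarrow> 'k) \<Rightarrow> ('a \<Rightarrow> 'a) \<Rightarrow> 'a \<Rightarrow> 'a" where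
  "hilbert_adjoint ip T = (SOME S. \<forall>x y. ip (T x) y = ip x (S y))"

definition normal_operator :: "('a \<Rightarrow> 'a \<Rightarrow> 'k) \<Rightarrow> ('a \<Rightarrow> 'a) \<Rightarrow> bool" where
  "normal_operator ip T \<longleftrightarrow> T \<circ> hilbert_adjoint ip T = hilbert_adjoint ip T \<circ> T"

text \<open>
  Self-adjointness is automatic over the complex numbers but not over the reals.
\<close>

definition positive_operator :: "('a \<Rightarrow> 'a \<Rightarrow> 'k::hilbert_scalar) \<Rightarrow> ('a \<Rightarrow> 'a) \<Rightarrow> bool" where
  "positive_operator ip A \<longleftrightarrow>
     (\<forall>x y. ip (A x) y = ip x (A y)) \<and> (\<forall>x. \<exists>r\<ge>0. ip (A x) x = of_real r)"

definition hyponormal_operator ::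
    "('a::ab_group_add \<Rightarrow> 'a \<Rightarrow> 'k::hilbert_scalar) \<Rightarrow> ('a \<Rightarrow> 'a) \<Rightarrow> bool" where
  "hyponormal_operator ip T \<longleftrightarrow>
     positive_operator ip (\<lambda>x. hilbert_adjoint ip T (T x) - T (hilbert_adjoint ip T x))"

end

theory Submission
  imports Defs
begin

text \<open>
  Hyponormality gives \<open>\<parallel>T\<^sup>* y\<parallel> \<le> \<parallel>T y\<parallel>\<close>. If the range \<open>R\<close> of \<open>T\<close> is closed, then the functionals
  \<open>\<langle>\<cdot>, y\<rangle> / \<parallel>T\<^sup>* y\<parallel>\<close>, \<open>y \<in> R\<close>, are pointwise bounded on the Banach space \<open>R\<close>, because
  \<open>\<bar>\<langle>T x, y\<rangle>\<bar> = \<bar>\<langle>x, T\<^sup>* y\<rangle>\<bar> \<le> \<parallel>x\<parallel> \<parallel>T\<^sup>* y\<parallel>\<close>; by uniform boundedness \<open>\<parallel>y\<parallel> \<le> B \<parallel>T\<^sup>* y\<parallel> \<le> B \<parallel>T y\<parallel>\<close>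
  on \<open>R\<close>. Being bounded below there, \<open>T\<close> maps closed subspaces of \<open>R\<close> to closed subspaces of \<open>R\<close>.
\<close>

section \<open>Uniform boundedness on a closed subspace\<close>

text \<open>The Baire category theorem is applied inside \<open>S\<close>, which is closed and hence
  completely metrizable. The relative form is what is needed for \<open>range T\<close>, a subspace
  and not a type of its own.\<close>

lemma uniform_boundedness_on:
  fixes F :: "('a::banach \<Rightarrow> 'b::real_normed_vector) set"
  assumes S: "subspace S" "closed S"
    and lin: "\<And>f. f \<in> F \<Longrightarrow> bounded_linear f"
    and bdd: "\<And>x. x \<in> S \<Longrightarrow> \<exists>K. \<forall>f\<in>F. norm (f x) \<le> K"
  obtains B where "\<And>f x. f \<in> F \<Longrightarrow> x \<in> S \<Longrightarrow> norm (f x) \<le> B * norm x"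
proof -
  define A where "A k = S \<inter> (\<Inter>f\<in>F. {x. norm (f x) \<le> real k})" for k
  have clA: "closedin (top_of_set S) (A k)" for k
    unfolding A_def
    by (intro closedin_closed_Int closed_INT ballI closed_Collect_le continuous_on_norm
        continuous_on_const linear_continuous_on lin)
  have UA: "(\<Union>k. A k) = S"
  proof
    show "S \<subseteq> (\<Union>k. A k)"
    proof
      fix x assume "x \<in> S"
      then obtain K where K: "\<forall>f\<in>F. norm (f x) \<le> K" using bdd by blast
      obtain k where "K \<le> real k" using real_arch_simple by blast
      with K \<open>x \<in> S\<close> show "x \<in> (\<Union>k. A k)" unfolding A_def by (force intro: order_trans)
    qed
  qed (auto simp: A_def)
  \<comment> \<open>Otherwise Baire would give \<open>S\<close> empty interior in itself, although
    \<open>S\<close> is open in itself and contains 0.\<close>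
  have "\<exists>k. top_of_set S interior_of (A k) \<noteq> {}"
  proof (rule ccontr)
    assume "\<not> ?thesis"
    then have "top_of_set S interior_of \<Union>(range A) = {}"
      using clA S completely_metrizable_space_closedin[OF completely_metrizable_space_euclidean]
      by (intro Baire_category_alt) auto
    then show False
      using UA subspace_0[OF \<open>subspace S\<close>] interior_of_topspace[of "top_of_set S"] by auto
  qed
  then obtain k x0 where "x0 \<in> top_of_set S interior_of (A k)" by blast
  then obtain e where e: "e > 0" "ball x0 e \<inter> S \<subseteq> A k" and x0: "x0 \<in> S"
    using openin_interior_of[of "top_of_set S" "A k"] interior_of_subset[of "top_of_set S" "A k"]
    unfolding openin_contains_ball by blast
  have "norm (f x) \<le> (4 * real k / e) * norm x" if f: "f \<in> F" and x: "x \<in> S" for f x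
  proof (cases "x = 0")
    case True
    then show ?thesis using lin[OF f] by (simp add: linear_simps)
  next
    case False
    interpret bounded_linear f by (rule lin[OF f])
    \<comment> \<open>This choice gives \<open>t *\<^sub>R x\<close> the norm \<open>e / 2\<close>,
      so \<open>x0 + t *\<^sub>R x\<close> stays in the ball. Both it and \<open>x0\<close> then lie
      in \<open>A k\<close>, and their values under \<open>f\<close> differ by
      \<open>t *\<^sub>R f x\<close>.\<close>
    define t where "t = e / (2 * norm x)"
    have t: "t > 0" using e False by (simp add: t_def)
    have "x0 + t *\<^sub>R x \<in> ball x0 e \<inter> S"
      using e False S x x0 by (auto simp: dist_norm t_def intro!: subspace_add subspace_scale)
    with e f have "norm (f (x0 + t *\<^sub>R x)) \<le> real k" by (auto simp: A_def)
    moreover have "x0 \<in> A k" using e x0 by auto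
    then have "norm (f x0) \<le> real k" using f by (auto simp: A_def)
    ultimately have "norm (f (x0 + t *\<^sub>R x) - f x0) \<le> 2 * real k"
      using norm_triangle_ineq4[of "f (x0 + t *\<^sub>R x)" "f x0"] by linarith
    then have "t * norm (f x) \<le> 2 * real k"
      using t by (simp add: add scaleR)
    then show ?thesis using e False by (simp add: t_def field_simps)
  qed
  then show thesis by (rule that)
qed

section \<open>Inner product identities and the Cauchy-Schwarz inequality\<close>

context hilbert_space
begin

lemma ip_add_right: "ip x (y + z) = ip x y + ip x z"
  by (simp only: inner_conj_sym[of x] inner_add_left sconj_add)

lemma ip_scale_right: "ip x (smul c y) = sconj c * ip x y"
  by (simp only: inner_conj_sym[of x] inner_scale_left sconj_mult)

lemma smul_minus_one: "smul (- 1) x = - x"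
  using scale_minus_left[of 1 x] by simp

lemma ip_minus_left: "ip (- x) y = - ip x y"
  using inner_scale_left[of "- 1" x y] by (simp add: smul_minus_one)

lemma ip_diff_left: "ip (x - y) z = ip x z - ip y z"
  using inner_add_left[of x "- y" z] by (simp add: ip_minus_left)

lemma ip_diff_right: "ip x (y - z) = ip x y - ip x z"
  using ip_add_right[of x y "- z"] ip_scale_right[of x "- 1" z] sconj_of_real[of "- 1", where 'k='k]
  by (simp add: smul_minus_one)

lemma parallelogram:
  fixes x y :: 'a
  shows "(norm (x + y))\<^sup>2 + (norm (x - y))\<^sup>2 = 2 * (norm x)\<^sup>2 + 2 * (norm y)\<^sup>2"
proof -
  have "ip (x + y) (x + y) + ip (x - y) (x - y) = 2 * ip x x + 2 * ip y y"
    by (simp add: inner_add_left ip_add_right ip_diff_left ip_diff_right)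
  then have "(of_real ((norm (x + y))\<^sup>2 + (norm (x - y))\<^sup>2) :: 'k)
      = of_real (2 * (norm x)\<^sup>2 + 2 * (norm y)\<^sup>2)"
    by (simp only: inner_self of_real_add of_real_mult of_real_numeral)
  then show ?thesis by (simp only: of_real_eq_iff)
qed

text \<open>Pythagoras for the residual of \<open>x\<close> after projection onto the line through
  \<open>y\<close>; for \<open>y = 0\<close> it rests on division by zero being zero. Nonnegativity
  of the left side yields Cauchy-Schwarz, and minimality in the Riesz argument yields
  orthogonality.\<close>

lemma norm_diff_projection:
  "(norm (x - smul (ip x y / of_real ((norm y)\<^sup>2)) y))\<^sup>2
    = (norm x)\<^sup>2 - (norm (ip x y))\<^sup>2 / (norm y)\<^sup>2"
proof (cases "y = 0")
  case True
  then show ?thesis by simp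
next
  case False
  define c where "c = ip x y / of_real ((norm y)\<^sup>2)"
  have c: "ip x y = c * of_real ((norm y)\<^sup>2)" using False by (simp add: c_def)
  have norm_c: "norm c = norm (ip x y) / (norm y)\<^sup>2"
    by (simp add: c_def norm_divide del: of_real_power)
  have "(of_real ((norm (x - smul c y))\<^sup>2) :: 'k) = of_real ((norm x)\<^sup>2)
      - sconj c * ip x y - (c * sconj (ip x y) - c * (sconj c * of_real ((norm y)\<^sup>2)))"
    by (simp only: inner_self[symmetric] ip_diff_left ip_diff_right inner_scale_left ip_scale_right
        inner_conj_sym[of y x]) (simp add: algebra_simps)
  also have "\<dots> = of_real ((norm x)\<^sup>2) - c * sconj c * of_real ((norm y)\<^sup>2)"
    by (simp only: c sconj_mult sconj_of_real) (simp add: algebra_simps)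
  also have "\<dots> = of_real ((norm x)\<^sup>2 - (norm c)\<^sup>2 * (norm y)\<^sup>2)"
    by (simp only: mult_sconj of_real_diff of_real_mult)
  finally have "(norm (x - smul c y))\<^sup>2 = (norm x)\<^sup>2 - (norm c)\<^sup>2 * (norm y)\<^sup>2"
    by (simp only: of_real_eq_iff)
  also have "(norm c)\<^sup>2 * (norm y)\<^sup>2 = (norm (ip x y))\<^sup>2 / (norm y)\<^sup>2"
    using False by (simp add: norm_c field_simps power2_eq_square)
  finally show ?thesis by (simp only: c_def)
qed

lemma Cauchy_Schwarz: "norm (ip x y) \<le> norm x * norm y"
proof (cases "y = 0")
  case True
  then show ?thesis using ip_diff_right[of x 0 0] by simp
next
  case False
  have "0 \<le> (norm x)\<^sup>2 - (norm (ip x y))\<^sup>2 / (norm y)\<^sup>2"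
    by (metis norm_diff_projection zero_le_power2)
  with False have "(norm (ip x y))\<^sup>2 \<le> (norm x * norm y)\<^sup>2"
    by (simp add: field_simps power_mult_distrib)
  then show ?thesis by (simp add: power2_le_iff_abs_le)
qed

lemma bounded_linear_ip_left: "bounded_linear (\<lambda>x. ip x y)"
proof (rule bounded_linear_intro[of _ "norm y"])
  show "ip (r *\<^sub>R x) y = r *\<^sub>R ip x y" for r x
    by (metis inner_scale_left scale_of_real scaleR_conv_of_real)
qed (simp_all add: inner_add_left Cauchy_Schwarz)

section \<open>Vectors of minimal norm and the Riesz representation\<close>

text \<open>The parallelogram law makes a minimizing sequence Cauchy; convexity enters through
  midpoints.\<close>

lemma minimal_norm_exists:
  fixes C :: "'a set"
  assumes C: "closed C" "C \<noteq> {}"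
    and mid: "\<And>x y. x \<in> C \<Longrightarrow> y \<in> C \<Longrightarrow> (1/2) *\<^sub>R (x + y) \<in> C"
  obtains u where "u \<in> C" "\<And>x. x \<in> C \<Longrightarrow> norm u \<le> norm x"
proof -
  define d where "d = (INF x\<in>C. (norm x)\<^sup>2)"
  have bb: "bdd_below ((\<lambda>x. (norm x)\<^sup>2) ` C)" by (rule bdd_belowI[of _ 0]) auto
  have d: "d \<le> (norm x)\<^sup>2" if "x \<in> C" for x
    unfolding d_def using bb that by (rule cINF_lower)
  have "\<exists>x\<in>C. (norm x)\<^sup>2 < d + 1 / real (Suc n)" for n
    using cINF_less_iff[OF C(2) bb, of "d + 1 / real (Suc n)"] unfolding d_def by simp
  then have "\<forall>n. \<exists>x. x \<in> C \<and> (norm x)\<^sup>2 < d + 1 / real (Suc n)" by blast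
  from choice[OF this] obtain X
    where XC: "\<And>n. X n \<in> C" and X: "\<And>n. (norm (X n))\<^sup>2 < d + 1 / real (Suc n)"
    by blast
  \<comment> \<open>The midpoint of \<open>X m\<close> and \<open>X n\<close> lies in
    \<open>C\<close>, so its squared norm is at least \<open>d\<close>; the parallelogram law bounds
    what is left for the difference.\<close>
  have gap: "(norm (X m - X n))\<^sup>2 < 2 / real (Suc m) + 2 / real (Suc n)" for m n
  proof -
    have "d \<le> (norm ((1/2) *\<^sub>R (X m + X n)))\<^sup>2" by (intro d mid XC)
    then have "4 * d \<le> (norm (X m + X n))\<^sup>2" by (simp add: power_divide)
    then show ?thesis using parallelogram[of "X m" "X n"] X[of m] X[of n] by simp
  qed
  have "Cauchy X"
  proof (rule CauchyI)
    fix e :: real assume e: "e > 0"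
    \<comment> \<open>From \<open>N\<close> on, the two terms of \<open>gap\<close> add up to at
      most \<open>4 / real (Suc N)\<close>, hence the quarter.\<close>
    obtain N where "inverse (real (Suc N)) < e\<^sup>2 / 4"
      using reals_Archimedean[of "e\<^sup>2 / 4"] e by auto
    then have N: "4 / real (Suc N) < e\<^sup>2" by (simp add: field_simps)
    show "\<exists>M. \<forall>m\<ge>M. \<forall>n\<ge>M. norm (X m - X n) < e"
    proof (intro exI allI impI)
      fix m n assume mn: "m \<ge> N" "n \<ge> N"
      have "2 / real (Suc m) \<le> 2 / real (Suc N)" "2 / real (Suc n) \<le> 2 / real (Suc N)"
        using mn by (intro divide_left_mono; simp)+
      then have "(norm (X m - X n))\<^sup>2 < e\<^sup>2" using gap[of m n] N by simp
      then show "norm (X m - X n) < e" using e by (simp add: power2_less_imp_less)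
    qed
  qed
  then obtain u where u: "X \<longlonglongrightarrow> u" using Cauchy_convergent convergent_def by blast
  have "u \<in> C" using C(1) XC u closed_sequentially by blast
  moreover have "norm u \<le> norm x" if "x \<in> C" for x
  proof -
    have "(\<lambda>n. d + 1 / real (Suc n)) \<longlonglongrightarrow> d + 0"
      by (intro tendsto_intros LIMSEQ_Suc[OF lim_1_over_n])
    moreover have "(\<lambda>n. (norm (X n))\<^sup>2) \<longlonglongrightarrow> (norm u)\<^sup>2"
      by (intro tendsto_intros u)
    ultimately have "(norm u)\<^sup>2 \<le> d + 0"
      using X by (intro LIMSEQ_le) (blast intro: less_imp_le)+
    with d[OF that] show ?thesis by (simp add: power2_le_imp_le)
  qed
  ultimately show thesis by (rule that)
qed

text \<open>Minimality makes the shortest vector \<open>u\<close> of the hyperplane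
  \<open>f x = 1\<close> orthogonal to the kernel of \<open>f\<close>; dividing \<open>u\<close> by
  its squared norm gives the representing vector.\<close>

lemma Riesz_representation:
  assumes add: "\<And>x y. f (x + y) = f x + f y"
    and scale: "\<And>c x. f (smul c x) = c * f x"
    and bdd: "\<And>x. norm (f x) \<le> K * norm x"
  shows "\<exists>z. \<forall>x. f x = ip x z"
proof (cases "\<forall>x. f x = 0")
  case True
  have "ip x 0 = 0" for x using ip_diff_right[of x 0 0] by simp
  with True show ?thesis by metis
next
  case False
  then obtain a where a: "f a \<noteq> 0" by blast
  have scaleR: "f (r *\<^sub>R x) = r *\<^sub>R f x" for r x
    by (metis scale scale_of_real scaleR_conv_of_real)
  interpret f: bounded_linear f
    by (rule bounded_linear_intro[of _ K]) (simp_all add: add scaleR bdd mult.commute)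
  define C where "C = {x. f x = 1}"
  have "closed C" unfolding C_def
    by (intro closed_Collect_eq linear_continuous_on f.bounded_linear_axioms continuous_on_const)
  moreover have "smul (1 / f a) a \<in> C" using a by (simp add: C_def scale)
  moreover have "(1/2) *\<^sub>R (x + y) \<in> C" if "x \<in> C" "y \<in> C" for x y
    using that by (simp add: C_def scaleR add scaleR_conv_of_real)
  ultimately obtain u where u: "u \<in> C" and umin: "\<And>x. x \<in> C \<Longrightarrow> norm u \<le> norm x"
    using minimal_norm_exists[of C] by blast
  have "u \<noteq> 0" using u f.zero by (auto simp: C_def)
  have orth: "ip u v = 0" if v: "f v = 0" for v
  proof (cases "v = 0")
    case True
    then show ?thesis using ip_diff_right[of u 0 0] by simp
  next
    case False
    \<comment> \<open>Subtracting a multiple of \<open>v\<close> keeps the value of \<open>f\<close>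
      at 1, so \<open>?w\<close> competes with \<open>u\<close>, and it would be shorter unless
      \<open>ip u v = 0\<close>.\<close>
    let ?w = "u - smul (ip u v / of_real ((norm v)\<^sup>2)) v"
    have "?w \<in> C" using u v by (simp add: C_def f.diff scale)
    then have "(norm u)\<^sup>2 \<le> (norm ?w)\<^sup>2" using umin by (simp add: power_mono)
    then have "(norm (ip u v))\<^sup>2 / (norm v)\<^sup>2 \<le> 0" by (simp only: norm_diff_projection)
    with False show ?thesis by (simp add: divide_le_0_iff)
  qed
  have "f x = ip x (smul (of_real (1 / (norm u)\<^sup>2)) u)" for x
  proof -
    \<comment> \<open>Since \<open>f u = 1\<close>, the vector \<open>x - smul (f x) u\<close> lies
      in the kernel of \<open>f\<close>.\<close>
    have "ip u (x - smul (f x) u) = 0"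
      using u by (intro orth) (simp add: f.diff scale C_def)
    then have "ip (x - smul (f x) u) u = 0"
      using inner_conj_sym[of "x - smul (f x) u" u] sconj_of_real[of 0, where 'k = 'k] by simp
    then have "ip x u = f x * of_real ((norm u)\<^sup>2)"
      by (simp add: ip_diff_left inner_scale_left inner_self)
    then show ?thesis
      using \<open>u \<noteq> 0\<close> by (simp only: ip_scale_right sconj_of_real) simp
  qed
  then show ?thesis by blast
qed

section \<open>The adjoint and hyponormality\<close>

text \<open>Riesz supplies a vector for every \<open>y\<close>, so the choice in
  \<open>hilbert_adjoint\<close> has a witness.\<close>

lemma hilbert_adjoint_right:
  assumes "bounded_operator smul T"
  shows "ip (T x) y = ip x (hilbert_adjoint ip T y)"
proof -
  interpret T: Vector_Spaces.linear smul smul T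
    using assms by (simp add: bounded_operator_def)
  obtain K where K: "\<And>x. norm (T x) \<le> K * norm x"
    using assms by (auto simp: bounded_operator_def)
  have "\<exists>z. \<forall>x. ip (T x) y = ip x z" for y
  proof (rule Riesz_representation)
    show "norm (ip (T x) y) \<le> (K * norm y) * norm x" for x
      using Cauchy_Schwarz[of "T x" y] mult_right_mono[OF K[of x], of "norm y"]
      by (simp add: mult_ac)
  qed (simp_all add: T.add T.scale inner_add_left inner_scale_left)
  then have "\<exists>S. \<forall>x y. ip (T x) y = ip x (S y)" by metis
  then show ?thesis
    unfolding hilbert_adjoint_def by (rule someI2_ex) blast
qed

lemma hilbert_adjoint_left:
  assumes "bounded_operator smul T"
  shows "ip (hilbert_adjoint ip T x) y = ip x (T y)"
proof -
  have "ip (hilbert_adjoint ip T x) y = sconj (ip y (hilbert_adjoint ip T x))"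
    by (rule inner_conj_sym)
  also have "\<dots> = sconj (ip (T y) x)" by (simp only: hilbert_adjoint_right[OF assms])
  also have "\<dots> = ip x (T y)" by (rule inner_conj_sym[symmetric])
  finally show ?thesis .
qed

lemma bounded_linear_operator:
  assumes "bounded_operator smul T"
  shows "bounded_linear T"
proof -
  interpret T: Vector_Spaces.linear smul smul T
    using assms by (simp add: bounded_operator_def)
  obtain K where "\<And>x. norm (T x) \<le> K * norm x"
    using assms by (auto simp: bounded_operator_def)
  moreover have "T (r *\<^sub>R x) = r *\<^sub>R T x" for r x
    by (metis T.scale scale_of_real)
  ultimately show ?thesis
    by (intro bounded_linear_intro[of _ K]) (simp_all add: T.add mult.commute)
qed

text \<open>The self-commutator of a normal operator is zero, and zero is positive.\<close>

lemma normal_imp_hyponormal: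
  assumes "normal_operator ip T"
  shows "hyponormal_operator ip T"
proof -
  have "hilbert_adjoint ip T (T x) = T (hilbert_adjoint ip T x)" for x
    using fun_cong[OF assms[unfolded normal_operator_def], of x] by simp
  then have zero: "(\<lambda>x. hilbert_adjoint ip T (T x) - T (hilbert_adjoint ip T x)) = (\<lambda>x. 0)"
    by simp
  have ip0: "ip 0 x = 0" "ip x 0 = 0" for x
    using ip_diff_left[of x x x] ip_diff_right[of x x x] by simp_all
  have "\<exists>r\<ge>0. (0 :: 'k) = of_real r" by (rule exI[of _ 0]) simp
  then show ?thesis
    unfolding hyponormal_operator_def positive_operator_def zero by (simp only: ip0 simp_thms)
qed

text \<open>Pairing the positive self-commutator at \<open>x\<close> with \<open>x\<close> gives the
  difference of the two squared norms.\<close>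

lemma norm_adjoint_le:
  assumes T: "bounded_operator smul T" and "hyponormal_operator ip T"
  shows "norm (hilbert_adjoint ip T x) \<le> norm (T x)"
proof -
  let ?S = "hilbert_adjoint ip T"
  have "\<exists>r\<ge>0. ip (?S (T x) - T (?S x)) x = of_real r"
    using assms(2) unfolding hyponormal_operator_def positive_operator_def by (elim conjE) (erule spec)
  then obtain r where "r \<ge> 0" and r: "ip (?S (T x) - T (?S x)) x = of_real r"
    by blast
  have "(of_real r :: 'k) = ip (?S (T x)) x - ip (T (?S x)) x"
    by (simp only: r[symmetric] ip_diff_left)
  also have "ip (?S (T x)) x = ip (T x) (T x)" by (rule hilbert_adjoint_left[OF T])
  also have "ip (T (?S x)) x = ip (?S x) (?S x)" by (rule hilbert_adjoint_right[OF T])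
  finally have "(of_real r :: 'k) = of_real ((norm (T x))\<^sup>2 - (norm (?S x))\<^sup>2)"
    by (simp only: inner_self of_real_diff)
  then have "r = (norm (T x))\<^sup>2 - (norm (?S x))\<^sup>2" by (simp only: of_real_eq_iff)
  with \<open>r \<ge> 0\<close> have "(norm (?S x))\<^sup>2 \<le> (norm (T x))\<^sup>2" by linarith
  then show ?thesis by (rule power2_le_imp_le) (rule norm_ge_zero)
qed

section \<open>Lower bounds on the range and closed ranges of powers\<close>

lemma adjoint_bounded_below_on_range:
  assumes T: "bounded_operator smul T" and cl: "closed (range T)"
  obtains B where "B > 0" "\<And>y. y \<in> range T \<Longrightarrow> norm y \<le> B * norm (hilbert_adjoint ip T y)"
proof -
  let ?S = "hilbert_adjoint ip T"
  \<comment> \<open>For \<open>?S y = 0\<close> the inverse is 0 and the functional vanishes, so the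
    pointwise bound holds there too; such \<open>y\<close> are handled separately below.\<close>
  define F where "F = (\<lambda>y x. ip x y /\<^sub>R norm (?S y)) ` range T"
  have sub: "Real_Vector_Spaces.subspace (range T)"
    using linear_subspace_image[OF bounded_linear.linear[OF bounded_linear_operator[OF T]]
        Real_Vector_Spaces.subspace_UNIV] .
  have pw: "norm (ip (T x) y /\<^sub>R norm (?S y)) \<le> norm x" for x y
    using Cauchy_Schwarz[of x "?S y"]
    by (cases "?S y = 0") (simp_all add: hilbert_adjoint_right[OF T] field_simps)
  have lin: "bounded_linear f" if "f \<in> F" for f
    using that bounded_linear_ip_left
    by (auto simp: F_def intro: bounded_linear_compose[OF bounded_linear_scaleR_right])
  have bdd: "\<exists>K. \<forall>f\<in>F. norm (f z) \<le> K" if z: "z \<in> range T" for z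
  proof -
    obtain x where "z = T x" using z by blast
    then have "\<forall>f\<in>F. norm (f z) \<le> norm x" using pw by (auto simp: F_def)
    then show ?thesis by blast
  qed
  obtain B where B: "\<And>f x. f \<in> F \<Longrightarrow> x \<in> range T \<Longrightarrow> norm (f x) \<le> B * norm x"
    using uniform_boundedness_on[OF sub cl lin bdd] by blast
  \<comment> \<open>Uniform boundedness says nothing about the sign of \<open>B\<close>;
    \<open>\<bar>B\<bar> + 1\<close> is a positive constant above it.\<close>
  have "norm y \<le> (\<bar>B\<bar> + 1) * norm (?S y)" if y: "y \<in> range T" for y
  proof (cases "?S y = 0 \<or> y = 0")
    case True
    obtain x where x: "y = T x" using y by blast
    have "y = 0"
    proof (rule disjE[OF True])
      \<comment> \<open>The kernel of the adjoint meets \<open>range T\<close> only in 0, as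
        \<open>ip (T x) y = ip x (?S y)\<close>.\<close>
      assume "?S y = 0"
      then have "ip y y = ip x 0" by (simp add: x hilbert_adjoint_right[OF T])
      then show "y = 0" using ip_diff_right[of x 0 0] inner_self[of y] by simp
    qed
    then show ?thesis by simp
  next
    case False
    \<comment> \<open>The functional belonging to \<open>y\<close> is evaluated at \<open>y\<close>
      itself.\<close>
    have "norm (ip y y /\<^sub>R norm (?S y)) \<le> B * norm y"
      by (rule B[of "\<lambda>x. ip x y /\<^sub>R norm (?S y)"]) (use y in \<open>auto simp: F_def\<close>)
    moreover have "norm (ip y y) = norm y * norm y"
      by (simp add: inner_self power2_eq_square del: of_real_power of_real_mult)
    ultimately have "norm y * norm y \<le> (B * norm (?S y)) * norm y"
      using False by (simp add: field_simps)
    then have "norm y \<le> B * norm (?S y)" using False by simp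
    also have "\<dots> \<le> (\<bar>B\<bar> + 1) * norm (?S y)" by (intro mult_right_mono) auto
    finally show ?thesis .
  qed
  then show thesis by (intro that[of "\<bar>B\<bar> + 1"]) auto
qed

text \<open>\<open>T\<close> is bounded below on its range and so carries complete subspaces of the
  range to complete subspaces. Starting at \<open>Suc 0\<close> keeps every subspace in the
  induction inside \<open>range T\<close>.\<close>

lemma closed_range_funpow:
  assumes T: "bounded_operator smul T" and cl: "closed (range T)" and hyp: "hyponormal_operator ip T"
  shows "closed (range (T ^^ Suc n))"
proof -
  obtain B where B: "B > 0" "\<And>y. y \<in> range T \<Longrightarrow> norm y \<le> B * norm (hilbert_adjoint ip T y)"
    using adjoint_bounded_below_on_range[OF T cl] by blast
  have below: "(1 / B) * norm y \<le> norm (T y)" if "y \<in> range T" for y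
  proof -
    have "norm y \<le> B * norm (T y)"
      using B(2)[OF that] mult_left_mono[OF norm_adjoint_le[OF T hyp, of y], of B] B(1) by linarith
    then show ?thesis using B(1) by (simp add: field_simps)
  qed
  have bl: "bounded_linear T" by (rule bounded_linear_operator[OF T])
  \<comment> \<open>The subspace property is carried along because
    \<open>complete_isometric_image\<close> requires it.\<close>
  have "Real_Vector_Spaces.subspace (range (T ^^ Suc n)) \<and> complete (range (T ^^ Suc n))"
  proof (induction n)
    case 0
    have "T ^^ Suc 0 = T" by simp
    then show ?case
      using linear_subspace_image[OF bounded_linear.linear[OF bl] Real_Vector_Spaces.subspace_UNIV] cl
      by (simp only: complete_eq_closed simp_thms)
  next
    case (Suc n)
    have eq: "range (T ^^ Suc (Suc n)) = T ` range (T ^^ Suc n)"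
      by (auto simp: image_image)
    have below': "\<forall>y\<in>range (T ^^ Suc n). norm (T y) \<ge> (1 / B) * norm y"
      using below by auto
    have "1 / B > 0" using B(1) by simp
    then have "complete (T ` range (T ^^ Suc n))"
      using Suc complete_isometric_image[OF _ _ bl below'] by blast
    moreover have "Real_Vector_Spaces.subspace (T ` range (T ^^ Suc n))"
      using Suc linear_subspace_image[OF bounded_linear.linear[OF bl]] by blast
    ultimately show ?case by (simp only: eq)
  qed
  then show ?thesis by (simp only: complete_eq_closed)
qed

end

theorem corollary2p3:
  fixes smul :: "'k::hilbert_scalar \<Rightarrow> 'a::banach \<Rightarrow> 'a"
    and ip :: "'a \<Rightarrow> 'a \<Rightarrow> 'k"
    and T :: "'a \<Rightarrow> 'a"
    and n :: nat
  assumes "hilbert_space smul ip"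
    and "bounded_operator smul T"
    and "closed (range T)"
    and "normal_operator ip T \<or> hyponormal_operator ip T"
    and "n \<ge> 1"
  shows "closed (range (T ^^ n))"
proof -
  interpret hilbert_space smul ip by fact
  have "hyponormal_operator ip T" using assms(4) normal_imp_hyponormal by blast
  moreover obtain m where "n = Suc m" using \<open>n \<ge> 1\<close> by (cases n) auto
  ultimately show ?thesis using closed_range_funpow assms(2,3) by blast
qed

end
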